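(* Let $a:\mathbb{R}\to(0,\infty)$ be a continuous, strictly positive function with period $1$, and let $f:[0,1]\to\mathbb{R}$ be smooth. Let $\overline{a} = \left(\int_0^1 \frac{1}{a(x)}\,dx\right)^{-1}$. For $\varepsilon>0$ let $u_\varepsilon$ be the solution of $$-\left(a\left(\tfrac{x}{\varepsilon}\right)u_\varepsilon'(x)\right)' = f(x)\quad\text{for } x\in(0,1),\qquad u_\varepsilon(0)=0=u_\varepsilon(1),$$ and let $u$ be the solution of the homogenized equation $$-\left(\overline{a}\,u'(x)\right)' = f(x)\quad\text{for } x\in(0,1),\qquad u(0)=0=u(1).$$ Define the affine function $$\ell_\varepsilon(x) = \varepsilon\left(\int_0^1 f(s)\,ds\right)\left(\int_0^1 a(y)^{-1}\left(y-\tfrac12\right)dy\right)x + \varepsilon\left(\int_0^1\int_0^y f(z)\,dz\,dy\right)\int_{-1/2}^{1/2}\int_0^y a(z)^{-1}\,dz\,dy .$$ Then there exists a constant $C>0$, depending only on $a$ and $f$, such that for all $\varepsilon>0$ with $\varepsilon^{-1}\in\mathbb{N}$ and all $x\in(\varepsilon,1-\varepsilon)$, $$\left|\frac{1}{\varepsilon}\int_{x-\varepsilon/2}^{x+\varepsilon/2}u_\varepsilon(y)\,dy - \ell_\varepsilon(x) - u(x)\right|\le C\,\varepsilon^2 .$$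
   Context: The coefficient $a$ is only assumed continuous, so the equation for $u_\varepsilon$ is understood in the sense that $u_\varepsilon\in C^1([0,1])$, the flux $x\mapsto a(x/\varepsilon)u_\varepsilon'(x)$ is continuously differentiable, and $-(a(x/\varepsilon)u_\varepsilon'(x))'=f(x)$. For $y<0$, $\int_0^y$ denotes the usual oriented integral $-\int_y^0$. *)

theory Defs
  imports "HOL-Analysis.Analysis"
begin

text \<open>
  Functions on the closed interval \<open>[0,1]\<close> are total functions \<open>real \<Rightarrow> real\<close> of which only the
  values on \<open>{0..1}\<close> matter. Derivatives on \<open>{0..1}\<close> are taken within the interval, hence
  one-sided at the endpoints.
\<close>

definition C1_on_with :: "real set \<Rightarrow> (real \<Rightarrow> real) \<Rightarrow> (real \<Rightarrow> real) \<Rightarrow> bool" where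
  "C1_on_with S g g' \<longleftrightarrow>
     (\<forall>x\<in>S. (g has_real_derivative g' x) (at x within S)) \<and> continuous_on S g'"

definition smooth_on_interval :: "real set \<Rightarrow> (real \<Rightarrow> real) \<Rightarrow> bool" where
  "smooth_on_interval S g \<longleftrightarrow>
     (\<exists>D :: nat \<Rightarrow> real \<Rightarrow> real. (\<forall>x\<in>S. D 0 x = g x) \<and>
        (\<forall>n. \<forall>x\<in>S. (D n has_real_derivative D (Suc n) x) (at x within S)))"

text \<open>
  \<open>dirichlet_solution A f u\<close>: \<open>u\<close> solves \<open>-(A u')' = f\<close> on \<open>(0,1)\<close> with \<open>u(0) = 0 = u(1)\<close>. The
  coefficient need not be differentiable, only the flux \<open>A u'\<close> is.
\<close>

definition dirichlet_solution ::
    "(real \<Rightarrow> real) \<Rightarrow> (real \<Rightarrow> real) \<Rightarrow> (real \<Rightarrow> real) \<Rightarrow> bool" where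
  "dirichlet_solution A f u \<longleftrightarrow>
     (\<exists>u' flux'. C1_on_with {0..1} u u' \<and>
        C1_on_with {0..1} (\<lambda>x. A x * u' x) flux' \<and>
        (\<forall>x\<in>{0<..<1}. - flux' x = f x)) \<and>
     u 0 = 0 \<and> u 1 = 0"

definition homogenized_coeff :: "(real \<Rightarrow> real) \<Rightarrow> real" where
  "homogenized_coeff a = inverse (LBINT x=0..1. 1 / a x)"

text \<open>
  The interval integral \<open>LBINT y=s..t\<close> is oriented, as needed for the inner integral of the last
  term when \<open>y < 0\<close>.
\<close>

definition affine_corrector :: "(real \<Rightarrow> real) \<Rightarrow> (real \<Rightarrow> real) \<Rightarrow> real \<Rightarrow> real \<Rightarrow> real" where
  "affine_corrector a f \<epsilon> x =
     \<epsilon> * (LBINT s=0..1. f s) * (LBINT y=0..1. inverse (a y) * (y - 1/2)) * x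
     + \<epsilon> * (LBINT y=0..1. (LBINT z=0..y. f z))
         * (LBINT y=ereal (-1/2)..ereal (1/2). (LBINT z=0..y. inverse (a z)))"

end

theory Submission
  imports Defs
begin

text \<open>
  Put \<open>b = 1/a\<close> with mean \<open>m\<close>, let \<open>B\<close> be the periodic primitive of \<open>b - m\<close> with \<open>B 0 = 0\<close>, let
  \<open>\<beta>\<close> be its mean and \<open>P\<close> the periodic primitive of \<open>B - \<beta>\<close>; let \<open>F\<close> be the primitive of \<open>f\<close> and
  \<open>\<Phi>\<close> that of \<open>F\<close>. Integrating the equation once gives \<open>u\<^sub>\<epsilon>' = b(x/\<epsilon>) (k - F)\<close>, and two integrations
  by parts give the exact formula
  \<open>u\<^sub>\<epsilon> = m (k x - \<Phi>) + \<epsilon> B(x/\<epsilon>) (k - F) + \<epsilon> \<beta> F + \<epsilon>\<^sup>2 P(x/\<epsilon>) f - \<epsilon>\<^sup>2 R\<close> with \<open>R' = P(x/\<epsilon>) f'\<close>.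
  As \<open>1/\<epsilon>\<close> is an integer, \<open>B\<close> and \<open>P\<close> vanish at \<open>1/\<epsilon>\<close>, so the boundary condition at \<open>1\<close> reads
  \<open>m (k - \<Phi> 1) = - \<epsilon> \<beta> F 1 + O(\<epsilon>\<^sup>2)\<close>. Averaging over one period replaces \<open>B(x/\<epsilon>)\<close> by \<open>\<beta>\<close>, which
  leaves \<open>u + \<epsilon> \<beta> \<Phi> 1 - \<epsilon> \<beta> F 1 x + O(\<epsilon>\<^sup>2)\<close>, and the two corrections form the affine corrector.
\<close>

section \<open>Primitives and first-order estimates in one variable\<close>

lemma primitive_exists:
  fixes g :: "real \<Rightarrow> real"
  assumes "continuous_on UNIV g"
  obtains G where "G 0 = 0" "\<And>x. (G has_real_derivative g x) (at x)"
proof -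
  have "isCont g x" for x
    using assms by (simp add: continuous_on_eq_continuous_at)
  then obtain G where G: "\<And>x. (G has_vector_derivative g x) (at x)"
    using einterval_antiderivative[of "-\<infinity>" "\<infinity>" g] by auto
  show thesis
  proof (rule that[of "\<lambda>x. G x - G 0"])
    show "((\<lambda>x. G x - G 0) has_real_derivative g x) (at x)" for x
      using G[of x] unfolding has_real_derivative_iff_has_vector_derivative[symmetric]
      by (auto intro!: derivative_eq_intros)
  qed simp
qed

lemma interval_integral_eq_primitive:
  fixes g G :: "real \<Rightarrow> real"
  assumes "continuous_on {min s t..max s t} g"
    and "\<And>x. x \<in> {min s t..max s t} \<Longrightarrow> (G has_real_derivative g x) (at x)"
  shows "(LBINT x=ereal s..ereal t. g x) = G t - G s"
proof (rule interval_integral_FTC_finite)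
  fix x assume "min s t \<le> x" "x \<le> max s t"
  then have "(G has_real_derivative g x) (at x within {min s t..max s t})"
    using assms(2)[of x] by (auto intro: has_field_derivative_at_within)
  then show "(G has_vector_derivative g x) (at x within {min s t..max s t})"
    by (simp add: has_real_derivative_iff_has_vector_derivative)
qed (use assms in auto)

text \<open>Serves as the uniqueness argument throughout: a solution is identified with an explicit
  formula by matching derivatives on \<open>{0..1}\<close>, one-sided at the endpoints, and the
  value at \<open>0\<close>.\<close>

lemma eq_on_unit_interval_if_same_derivative:
  fixes u v :: "real \<Rightarrow> real"
  assumes "\<And>x. x \<in> {0..1} \<Longrightarrow> (u has_real_derivative d x) (at x within {0..1})"
    and "\<And>x. x \<in> {0..1} \<Longrightarrow> (v has_real_derivative d x) (at x within {0..1})"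
    and "u 0 = v 0" and "x \<in> {0..1}"
  shows "u x = v x"
proof -
  have "((\<lambda>x. u x - v x) has_real_derivative 0) (at y within {0..1})" if "y \<in> {0..1}" for y
    using DERIV_diff[OF assms(1)[OF that] assms(2)[OF that]] by simp
  then obtain e where "\<And>y. y \<in> {0..1} \<Longrightarrow> u y - v y = e"
    using has_field_derivative_zero_constant[of "{0..1}" "\<lambda>x. u x - v x"] by auto
  from this[of 0] this[of x] show ?thesis using assms(3,4) by auto
qed

lemma increment_bound:
  fixes h :: "real \<Rightarrow> real"
  assumes "\<And>z. z \<in> {s..t} \<Longrightarrow> (h has_real_derivative h' z) (at z)"
    and "\<And>z. z \<in> {s..t} \<Longrightarrow> \<bar>h' z\<bar> \<le> K"
    and "x \<in> {s..t}" "y \<in> {s..t}"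
  shows "\<bar>h y - h x\<bar> \<le> K * \<bar>y - x\<bar>"
  using field_differentiable_bound[of "{s..t}" h h' K y x] assms
  by (auto intro: has_field_derivative_at_within)

text \<open>Subtracting the linear part leaves a function with derivative
  \<open>h' z - h' x\<close>, which is at most \<open>K * \<bar>y - x\<bar>\<close> between
  \<open>x\<close> and \<open>y\<close>; the mean value inequality contributes the second
  factor.\<close>

lemma taylor_first_order_bound:
  fixes h :: "real \<Rightarrow> real"
  assumes d: "\<And>z. z \<in> {s..t} \<Longrightarrow> (h has_real_derivative h' z) (at z)"
    and lip: "\<And>y z. y \<in> {s..t} \<Longrightarrow> z \<in> {s..t} \<Longrightarrow> \<bar>h' y - h' z\<bar> \<le> K * \<bar>y - z\<bar>"
    and "0 \<le> K" and x: "x \<in> {s..t}" and y: "y \<in> {s..t}"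
  shows "\<bar>h y - h x - h' x * (y - x)\<bar> \<le> K * (y - x)\<^sup>2"
proof -
  define S where "S = {min x y..max x y}"
  have S: "z \<in> S \<Longrightarrow> z \<in> {s..t}" "z \<in> S \<Longrightarrow> \<bar>z - x\<bar> \<le> \<bar>y - x\<bar>" for z
    using x y unfolding S_def by auto
  have "\<bar>(h y - h' x * y) - (h x - h' x * x)\<bar> \<le> (K * \<bar>y - x\<bar>) * \<bar>y - x\<bar>"
  proof (rule increment_bound[of "min x y" "max x y" "\<lambda>y. h y - h' x * y" "\<lambda>z. h' z - h' x"])
    fix z assume z: "z \<in> {min x y..max x y}"
    then have zS: "z \<in> S" by (simp add: S_def)
    show "((\<lambda>y. h y - h' x * y) has_real_derivative h' z - h' x) (at z)"
      using d[OF S(1)[OF zS]] by (auto intro!: derivative_eq_intros)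
    have "\<bar>h' z - h' x\<bar> \<le> K * \<bar>z - x\<bar>" using lip[OF S(1)[OF zS] x] .
    also have "\<dots> \<le> K * \<bar>y - x\<bar>" using S(2)[OF zS] \<open>0 \<le> K\<close> by (rule mult_left_mono)
    finally show "\<bar>h' z - h' x\<bar> \<le> K * \<bar>y - x\<bar>" .
  qed auto
  then show ?thesis
    by (simp add: algebra_simps power2_eq_square abs_mult_self_eq)
qed

section \<open>Periodic functions\<close>

lemma periodic_add_nat:
  fixes h :: "real \<Rightarrow> 'a"
  assumes "\<And>x. h (x + 1) = h x"
  shows "h (x + of_nat n) = h x"
proof (induction n)
  case (Suc n)
  have "h (x + of_nat (Suc n)) = h ((x + of_nat n) + 1)" by (simp add: algebra_simps)
  then show ?case using Suc assms by simp
qed simp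

text \<open>The integer part of \<open>x\<close> may be negative, while the previous lemma only
  shifts by naturals; hence the shift starts from \<open>frac x\<close> in one case and from
  \<open>x\<close> in the other.\<close>

lemma periodic_frac:
  fixes h :: "real \<Rightarrow> 'a"
  assumes "\<And>x. h (x + 1) = h x"
  shows "h (frac x) = h x"
proof (cases "0 \<le> \<lfloor>x\<rfloor>")
  case True
  then have "x = frac x + of_nat (nat \<lfloor>x\<rfloor>)" by (simp add: frac_def)
  then show ?thesis using periodic_add_nat[of h, OF assms] by metis
next
  case False
  then have "frac x = x + of_nat (nat (- \<lfloor>x\<rfloor>))" by (simp add: frac_def)
  then show ?thesis using periodic_add_nat[of h, OF assms] by metis
qed

lemma bounded_on_unit_interval:
  fixes h :: "real \<Rightarrow> real"
  assumes "continuous_on {0..1} h"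
  obtains K where "K \<ge> 0" "\<And>x. x \<in> {0..1} \<Longrightarrow> \<bar>h x\<bar> \<le> K"
proof -
  have "bounded (h ` {0..1})"
    using assms by (intro compact_imp_bounded compact_continuous_image) auto
  then obtain K where K: "\<forall>x\<in>{0..1}. \<bar>h x\<bar> \<le> K"
    unfolding bounded_real by blast
  show thesis
    by (rule that[of "max K 0"]) (use K in \<open>auto simp: le_max_iff_disj\<close>)
qed

lemma periodic_continuous_bounded:
  fixes h :: "real \<Rightarrow> real"
  assumes "continuous_on UNIV h" and per: "\<And>x. h (x + 1) = h x"
  obtains K where "K \<ge> 0" "\<And>x. \<bar>h x\<bar> \<le> K"
proof -
  obtain K where K: "K \<ge> 0" "\<And>x. x \<in> {0..1} \<Longrightarrow> \<bar>h x\<bar> \<le> K"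
    using bounded_on_unit_interval[of h] continuous_on_subset[OF assms(1)] by blast
  have "\<bar>h x\<bar> \<le> K" for x
    using K(2)[of "frac x"] periodic_frac[of h x, OF per] frac_lt_1[of x] by (auto simp: less_imp_le)
  with K(1) show thesis by (rule that)
qed

text \<open>The difference \<open>h (x + 1) - h x\<close> has zero derivative, so it keeps its value
  at \<open>0\<close>, which is \<open>h 1 - h 0\<close>.\<close>

lemma periodic_primitive:
  fixes h :: "real \<Rightarrow> real"
  assumes d: "\<And>x. (h has_real_derivative h' x) (at x)"
    and per: "\<And>x. h' (x + 1) = h' x" and "h 1 = h 0"
  shows "h (x + 1) = h x"
proof -
  have "((\<lambda>x. h (x + 1) - h x) has_real_derivative 0) (at y)" for y
    using DERIV_diff[OF DERIV_shift[THEN iffD1, OF d[of "y + 1"]] d[of y]] per[of y]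
    by simp
  then have "h (x + 1) - h x = h (0 + 1) - h 0"
    using DERIV_isconst_all[of "\<lambda>x. h (x + 1) - h x"] by blast
  then show ?thesis using assms(3) by simp
qed

section \<open>Extension of the data and first integration of the equation\<close>

text \<open>The first derivative is extended by constants through clamping its argument to
  \<open>[0,1]\<close>, then integrated from \<open>f 0\<close>. Afterwards all primitives of the
  data have two-sided derivatives on the whole line.\<close>

lemma smooth_on_unit_interval_C1_extension:
  assumes "smooth_on_interval {0..1} f"
  obtains f\<^sub>e f' :: "real \<Rightarrow> real" where "continuous_on UNIV f'"
    "\<And>x. (f\<^sub>e has_real_derivative f' x) (at x)" "\<And>x. x \<in> {0..1} \<Longrightarrow> f\<^sub>e x = f x"
proof -
  from assms obtain D :: "nat \<Rightarrow> real \<Rightarrow> real" where D0: "\<And>x. x \<in> {0..1} \<Longrightarrow> D 0 x = f x"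
    and D: "\<And>n x. x \<in> {0..1} \<Longrightarrow> (D n has_real_derivative D (Suc n) x) (at x within {0..1})"
    unfolding smooth_on_interval_def by blast
  define f' where "f' = (\<lambda>x. D 1 (max 0 (min 1 x)))"
  have "continuous_on {0..1} (D 1)"
    using D[of _ 1] by (meson DERIV_continuous_on)
  then have cont: "continuous_on UNIV f'"
    unfolding f'_def
    by (rule continuous_on_compose2[of "{0..1}"]) (auto intro!: continuous_intros)
  obtain h where h: "h 0 = 0" "\<And>x. (h has_real_derivative f' x) (at x)"
    by (rule primitive_exists[OF cont]) blast
  show thesis
  proof (rule that[of f' "\<lambda>x. h x + f 0"])
    show "((\<lambda>x. h x + f 0) has_real_derivative f' x) (at x)" for x
      using h(2)[of x] by (auto intro!: derivative_eq_intros)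
    then have *: "((\<lambda>x. h x + f 0) has_real_derivative f' x) (at x within {0..1})" for x
      by (rule has_field_derivative_at_within)
    fix x :: real assume x: "x \<in> {0..1}"
    have "h x + f 0 = D 0 x"
      by (rule eq_on_unit_interval_if_same_derivative[of _ f', OF * _ _ x])
        (use D[of _ 0] h(1) D0[of 0] in \<open>auto simp: f'_def\<close>)
    then show "h x + f 0 = f x" using D0[OF x] by simp
  qed (rule cont)
qed

lemma dirichlet_solution_derivative:
  assumes "dirichlet_solution A f u" and A: "\<And>x. x \<in> {0..1} \<Longrightarrow> A x \<noteq> 0"
    and F: "\<And>x. x \<in> {0..1} \<Longrightarrow> (F has_real_derivative f x) (at x)"
    and f: "continuous_on {0..1} f"
  obtains k where
    "\<And>x. x \<in> {0..1} \<Longrightarrow> (u has_real_derivative (k - F x) / A x) (at x within {0..1})"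
proof -
  from assms(1) obtain u' flux' where
    u': "\<And>x. x \<in> {0..1} \<Longrightarrow> (u has_real_derivative u' x) (at x within {0..1})"
    and flux: "\<And>x. x \<in> {0..1} \<Longrightarrow>
      ((\<lambda>x. A x * u' x) has_real_derivative flux' x) (at x within {0..1})"
    and cont: "continuous_on {0..1} flux'"
    and eq: "\<And>x. x \<in> {0<..<1} \<Longrightarrow> - flux' x = f x"
    unfolding dirichlet_solution_def C1_on_with_def by blast
  \<comment> \<open>The equation is given on the open interval only; both sides are continuous, so
    it persists at the endpoints.\<close>
  have "flux' x = - f x" if "x \<in> {0..1}" for x
  proof -
    have "continuous_on {0..1} (\<lambda>x. flux' x + f x)" using cont f by (intro continuous_intros)
    then have "flux' x + f x = 0"
      using continuous_constant_on_closure[of "{0<..<1}" "\<lambda>x. flux' x + f x" 0 x] eq that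
      by fastforce
    then show ?thesis by simp
  qed
  with flux have flux: "\<And>x. x \<in> {0..1} \<Longrightarrow>
      ((\<lambda>x. A x * u' x) has_real_derivative - f x) (at x within {0..1})" by force
  \<comment> \<open>By the equation \<open>A x * u' x + F x\<close> is constant; \<open>k\<close> is
    its value at \<open>0\<close>.\<close>
  define k where "k = A 0 * u' 0 + F 0"
  have kF: "((\<lambda>x. k - F x) has_real_derivative - f x) (at x within {0..1})" if "x \<in> {0..1}" for x
    using has_field_derivative_at_within[OF F[OF that]] by (auto intro!: derivative_eq_intros)
  have "A x * u' x = k - F x" if "x \<in> {0..1}" for x
    by (rule eq_on_unit_interval_if_same_derivative[of "\<lambda>x. A x * u' x" "\<lambda>x. - f x", OF flux kF])
      (use that in \<open>auto simp: k_def\<close>)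
  then have "u' x = (k - F x) / A x" if "x \<in> {0..1}" for x
    using A[OF that] that by (simp add: field_simps)
  with u' show thesis by (intro that[of k]) force
qed

section \<open>The exact expansion of the oscillating solution\<close>

text \<open>Everything fixed here is independent of \<epsilon>, so a constant built from these
  parameters is uniform in \<epsilon>. The role of \<open>f\<close> is played by an extension of the
  right-hand side to the whole line.\<close>

locale oscillating_problem =
  fixes b B P :: "real \<Rightarrow> real" and m \<beta> :: real and f f' F \<Phi> :: "real \<Rightarrow> real"
    and K\<^sub>B K\<^sub>P K K' :: real
  assumes m_pos: "0 < m"
    and B_deriv: "\<And>y. (B has_real_derivative b y - m) (at y)"
    and P_deriv: "\<And>y. (P has_real_derivative B y - \<beta>) (at y)"
    and B_periodic: "\<And>y. B (y + 1) = B y" and P_periodic: "\<And>y. P (y + 1) = P y"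
    and B_0: "B 0 = 0" and P_0: "P 0 = 0"
    and B_bound: "\<And>y. \<bar>B y\<bar> \<le> K\<^sub>B" and P_bound: "\<And>y. \<bar>P y\<bar> \<le> K\<^sub>P"
    and f'_cont: "continuous_on UNIV f'"
    and f_deriv: "\<And>x. (f has_real_derivative f' x) (at x)"
    and F_deriv: "\<And>x. (F has_real_derivative f x) (at x)"
    and \<Phi>_deriv: "\<And>x. (\<Phi> has_real_derivative F x) (at x)"
    and F_0: "F 0 = 0" and \<Phi>_0: "\<Phi> 0 = 0"
    and f_bound: "\<And>x. x \<in> {0..1} \<Longrightarrow> \<bar>f x\<bar> \<le> K"
    and f'_bound: "\<And>x. x \<in> {0..1} \<Longrightarrow> \<bar>f' x\<bar> \<le> K'"
begin

lemma bounds_nonneg: "0 \<le> K\<^sub>B" "0 \<le> K\<^sub>P" "0 \<le> K" "0 \<le> K'"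
  using B_bound[of 0] P_bound[of 0] f_bound[of 0] f'_bound[of 0] by auto

lemma F_lipschitz:
  assumes "x \<in> {0..1}" "y \<in> {0..1}"
  shows "\<bar>F y - F x\<bar> \<le> K * \<bar>y - x\<bar>"
  by (rule increment_bound[of 0 1 F f]) (use F_deriv f_bound assms in auto)

lemma \<Phi>_taylor:
  assumes "x \<in> {0..1}" "y \<in> {0..1}"
  shows "\<bar>\<Phi> y - \<Phi> x - F x * (y - x)\<bar> \<le> K * (y - x)\<^sup>2"
  by (rule taylor_first_order_bound[of 0 1 \<Phi> F])
    (use \<Phi>_deriv F_lipschitz bounds_nonneg assms in auto)

text \<open>Integration gives \<open>m * (k * x - \<Phi> x)\<close>, and the condition at
  \<open>1\<close> forces \<open>k = \<Phi> 1\<close> because \<open>m\<close> is nonzero.\<close>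

lemma homogenized_solution:
  assumes "\<And>x. x \<in> {0..1} \<Longrightarrow>
      (u has_real_derivative m * (k - F x)) (at x within {0..1})"
    and "u 0 = 0" "u 1 = 0" "x \<in> {0..1}"
  shows "u x = m * (\<Phi> 1 * x - \<Phi> x)"
proof -
  have *: "((\<lambda>x. m * (k * x - \<Phi> x)) has_real_derivative m * (k - F x)) (at x within {0..1})" for x
    by (rule has_field_derivative_at_within)
      (auto intro!: derivative_eq_intros \<Phi>_deriv)
  have eq: "u x = m * (k * x - \<Phi> x)" if "x \<in> {0..1}" for x
    by (rule eq_on_unit_interval_if_same_derivative[OF assms(1) *])
      (use that assms \<Phi>_0 in auto)
  from eq[of 1] assms(3) m_pos have "k = \<Phi> 1" by simp
  with eq assms(4) show ?thesis by simp
qed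

text \<open>The term with \<open>\<beta> * F x\<close> arises from splitting \<open>B\<close> into
  its mean and \<open>B - \<beta>\<close> after the first integration by parts; the second one acts
  on \<open>B - \<beta>\<close>. The parameter \<open>R\<close> stands for the integral that is left
  over.\<close>

definition expansion :: "real \<Rightarrow> (real \<Rightarrow> real) \<Rightarrow> real \<Rightarrow> real \<Rightarrow> real" where
  "expansion \<epsilon> R k x = m * (k * x - \<Phi> x) + \<epsilon> * (B (x / \<epsilon>) * (k - F x)) + \<epsilon> * \<beta> * F x
     + \<epsilon>\<^sup>2 * (P (x / \<epsilon>) * f x) - \<epsilon>\<^sup>2 * R x"

lemma expansion_deriv:
  assumes "\<epsilon> > 0" and R: "\<And>x. (R has_real_derivative P (x / \<epsilon>) * f' x) (at x)"
  shows "(expansion \<epsilon> R k has_real_derivative b (x / \<epsilon>) * (k - F x)) (at x)"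
proof -
  have s: "((\<lambda>x. x / \<epsilon>) has_real_derivative 1 / \<epsilon>) (at x)"
    using DERIV_cdivide[OF DERIV_ident] .
  have B: "((\<lambda>x. B (x / \<epsilon>)) has_real_derivative (b (x / \<epsilon>) - m) * (1 / \<epsilon>)) (at x)"
    by (rule DERIV_chain2[OF B_deriv s])
  have P: "((\<lambda>x. P (x / \<epsilon>)) has_real_derivative (B (x / \<epsilon>) - \<beta>) * (1 / \<epsilon>)) (at x)"
    by (rule DERIV_chain2[OF P_deriv s])
  show ?thesis
    unfolding expansion_def
    apply (rule derivative_eq_intros \<Phi>_deriv F_deriv f_deriv B P R refl)+
    using assms(1) by (simp add: field_simps power2_eq_square)
qed

text \<open>Every term of the expansion vanishes at \<open>0\<close>, so it agrees with
  \<open>u\<close> on the interval. At \<open>1\<close> the oscillating terms drop out, and the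
  boundary condition becomes an equation for \<open>k\<close>.\<close>

lemma oscillating_solution:
  assumes \<epsilon>: "\<epsilon> > 0" "1 / \<epsilon> \<in> \<nat>"
    and R: "\<And>x. (R has_real_derivative P (x / \<epsilon>) * f' x) (at x)" "R 0 = 0"
    and u: "\<And>x. x \<in> {0..1} \<Longrightarrow>
      (u has_real_derivative b (x / \<epsilon>) * (k - F x)) (at x within {0..1})"
    and "u 0 = 0" "u 1 = 0"
  shows "\<And>x. x \<in> {0..1} \<Longrightarrow> u x = expansion \<epsilon> R k x"
    and "m * (k - \<Phi> 1) = \<epsilon>\<^sup>2 * R 1 - \<epsilon> * \<beta> * F 1"
proof -
  have *: "(expansion \<epsilon> R k has_real_derivative b (x / \<epsilon>) * (k - F x)) (at x within {0..1})" for x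
    by (rule has_field_derivative_at_within[OF expansion_deriv[OF \<epsilon>(1) R(1)]])
  show eq: "u x = expansion \<epsilon> R k x" if "x \<in> {0..1}" for x
    by (rule eq_on_unit_interval_if_same_derivative[OF u *])
      (use that assms \<Phi>_0 F_0 B_0 P_0 in \<open>auto simp: expansion_def\<close>)
  from \<epsilon>(2) obtain n where n: "1 / \<epsilon> = real n" by (auto elim: Nats_cases)
  have "B (1 / \<epsilon>) = 0" "P (1 / \<epsilon>) = 0"
    using periodic_add_nat[of B 0 n, OF B_periodic] periodic_add_nat[of P 0 n, OF P_periodic]
      B_0 P_0 n by auto
  with eq[of 1] \<open>u 1 = 0\<close> show "m * (k - \<Phi> 1) = \<epsilon>\<^sup>2 * R 1 - \<epsilon> * \<beta> * F 1"
    by (simp add: expansion_def algebra_simps)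
qed

section \<open>Averaging over one period and error bounds\<close>

text \<open>The summands bound, in this order and up to the factor
  \<open>\<epsilon>\<^sup>2\<close>, the five errors made when the expansion is frozen.\<close>

definition error_constant :: real where
  "error_constant = m * K + K\<^sub>B * K + \<bar>\<beta>\<bar> * K + K\<^sub>P * K + K\<^sub>P * K'"

lemma corrector_bound:
  assumes "\<epsilon> > 0" and R: "\<And>x. (R has_real_derivative P (x / \<epsilon>) * f' x) (at x)" "R 0 = 0"
    and "x \<in> {0..1}"
  shows "\<bar>R x\<bar> \<le> K\<^sub>P * K'"
proof -
  have "\<bar>R x - R 0\<bar> \<le> (K\<^sub>P * K') * \<bar>x - 0\<bar>"
    by (rule increment_bound[of 0 1 R, OF R(1)])
      (use assms P_bound f'_bound bounds_nonneg in \<open>auto simp: abs_mult intro!: mult_mono\<close>)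
  also have "\<dots> \<le> (K\<^sub>P * K') * 1"
    using assms(4) bounds_nonneg by (intro mult_left_mono) auto
  finally show ?thesis using R(2) by simp
qed

text \<open>The expansion is frozen at the centre \<open>x\<close> of the window; only \<open>B\<close> keeps oscillating.\<close>

lemma expansion_frozen:
  assumes \<epsilon>: "\<epsilon> > 0" and R: "\<And>x. (R has_real_derivative P (x / \<epsilon>) * f' x) (at x)" "R 0 = 0"
    and x: "x \<in> {0..1}" and y: "y \<in> {0..1}" and xy: "\<bar>y - x\<bar> \<le> \<epsilon>"
  shows "\<bar>expansion \<epsilon> R k y - (m * (k * y - \<Phi> x - F x * (y - x))
      + \<epsilon> * (B (y / \<epsilon>) * (k - F x)) + \<epsilon> * \<beta> * F x)\<bar> \<le> error_constant * \<epsilon>\<^sup>2"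
proof -
  \<comment> \<open>\<open>e1\<close> is the Taylor remainder of \<open>\<Phi>\<close>;
    \<open>e2\<close> and \<open>e3\<close> come from replacing \<open>F y\<close> by
    \<open>F x\<close> and gain a second factor \<epsilon> from the Lipschitz bound;
    \<open>e4\<close> and \<open>e5\<close> carry \<open>\<epsilon>\<^sup>2\<close>
    explicitly.\<close>
  define e1 where "e1 = m * (\<Phi> y - \<Phi> x - F x * (y - x))"
  define e2 where "e2 = \<epsilon> * (B (y / \<epsilon>) * (F y - F x))"
  define e3 where "e3 = \<epsilon> * (\<beta> * (F y - F x))"
  define e4 where "e4 = \<epsilon>\<^sup>2 * (P (y / \<epsilon>) * f y)"
  define e5 where "e5 = \<epsilon>\<^sup>2 * R y"
  have F: "\<bar>F y - F x\<bar> \<le> K * \<epsilon>"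
    using F_lipschitz[OF x y] mult_left_mono[OF xy bounds_nonneg(3)] by linarith
  have "(y - x)\<^sup>2 \<le> \<epsilon>\<^sup>2" using power_mono[OF xy, of 2] by simp
  then have "\<bar>\<Phi> y - \<Phi> x - F x * (y - x)\<bar> \<le> K * \<epsilon>\<^sup>2"
    using \<Phi>_taylor[OF x y] mult_left_mono[OF _ bounds_nonneg(3)] by force
  then have 1: "\<bar>e1\<bar> \<le> m * (K * \<epsilon>\<^sup>2)"
    unfolding e1_def using m_pos by (simp add: abs_mult)
  have 2: "\<bar>e2\<bar> \<le> \<epsilon> * (K\<^sub>B * (K * \<epsilon>))"
    unfolding e2_def abs_mult using \<epsilon> F B_bound bounds_nonneg
    by (auto intro!: mult_mono)
  have 3: "\<bar>e3\<bar> \<le> \<epsilon> * (\<bar>\<beta>\<bar> * (K * \<epsilon>))"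
    unfolding e3_def abs_mult using \<epsilon> F by (auto intro!: mult_left_mono)
  have 4: "\<bar>e4\<bar> \<le> \<epsilon>\<^sup>2 * (K\<^sub>P * K)"
    unfolding e4_def abs_mult using \<epsilon> f_bound[OF y] P_bound bounds_nonneg
    by (auto intro!: mult_mono)
  have 5: "\<bar>e5\<bar> \<le> \<epsilon>\<^sup>2 * (K\<^sub>P * K')"
    unfolding e5_def abs_mult using corrector_bound[OF \<epsilon> R y] by (auto intro!: mult_left_mono)
  have "expansion \<epsilon> R k y - (m * (k * y - \<Phi> x - F x * (y - x))
      + \<epsilon> * (B (y / \<epsilon>) * (k - F x)) + \<epsilon> * \<beta> * F x) = - e1 - e2 + e3 + e4 - e5"
    unfolding expansion_def e1_def e2_def e3_def e4_def e5_def by (simp add: algebra_simps)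
  also have "\<bar>\<dots>\<bar> \<le> m * (K * \<epsilon>\<^sup>2) + \<epsilon> * (K\<^sub>B * (K * \<epsilon>)) + \<epsilon> * (\<bar>\<beta>\<bar> * (K * \<epsilon>))
      + \<epsilon>\<^sup>2 * (K\<^sub>P * K) + \<epsilon>\<^sup>2 * (K\<^sub>P * K')"
    using 1 2 3 4 5 by linarith
  also have "\<dots> = error_constant * \<epsilon>\<^sup>2"
    unfolding error_constant_def by (simp add: algebra_simps power2_eq_square)
  finally show ?thesis .
qed

lemma window_average:
  assumes \<epsilon>: "\<epsilon> > 0" and R: "\<And>x. (R has_real_derivative P (x / \<epsilon>) * f' x) (at x)" "R 0 = 0"
    and x: "x \<in> {\<epsilon><..<1 - \<epsilon>}"
  shows "\<bar>1 / \<epsilon> * (LBINT y=ereal (x - \<epsilon> / 2)..ereal (x + \<epsilon> / 2). expansion \<epsilon> R k y)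
      - (m * (k * x - \<Phi> x) + \<epsilon> * \<beta> * k)\<bar> \<le> error_constant * \<epsilon>\<^sup>2"
proof -
  have cont: "continuous_on UNIV (expansion \<epsilon> R k)"
    by (rule DERIV_continuous_on[OF expansion_deriv[OF \<epsilon> R(1)]])
  obtain W where W: "\<And>y. (W has_real_derivative expansion \<epsilon> R k y) (at y)"
    by (rule primitive_exists[OF cont]) blast
  have avg: "(LBINT y=ereal (x - \<epsilon> / 2)..ereal (x + \<epsilon> / 2). expansion \<epsilon> R k y) = W (x + \<epsilon> / 2) - W (x - \<epsilon> / 2)"
    by (rule interval_integral_eq_primitive) (use W cont in \<open>auto intro: continuous_on_subset\<close>)
  \<comment> \<open>Here \<open>\<epsilon> * P (y / \<epsilon>) + \<beta> * y\<close> is a primitive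
    of \<open>B (y / \<epsilon>)\<close>.\<close>
  define N where "N = (\<lambda>y. m * (k * y\<^sup>2 / 2 - \<Phi> x * y - F x * (y - x)\<^sup>2 / 2)
      + \<epsilon> * ((\<epsilon> * P (y / \<epsilon>) + \<beta> * y) * (k - F x)) + \<epsilon> * \<beta> * F x * y)"
  have N: "(N has_real_derivative m * (k * y - \<Phi> x - F x * (y - x))
      + \<epsilon> * (B (y / \<epsilon>) * (k - F x)) + \<epsilon> * \<beta> * F x) (at y)" for y
  proof -
    have P: "((\<lambda>x. P (x / \<epsilon>)) has_real_derivative (B (y / \<epsilon>) - \<beta>) * (1 / \<epsilon>)) (at y)"
      by (rule DERIV_chain2[OF P_deriv DERIV_cdivide[OF DERIV_ident]])
    show ?thesis
      unfolding N_def
      using \<epsilon> by (auto intro!: derivative_eq_intros P simp: field_simps power2_eq_square)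
  qed
  \<comment> \<open>In the fast variable the window is exactly one period long.\<close>
  have "P ((x + \<epsilon> / 2) / \<epsilon>) = P ((x - \<epsilon> / 2) / \<epsilon> + 1)"
    using \<epsilon> by (intro arg_cong[of _ _ P]) (simp add: field_simps)
  then have "P ((x + \<epsilon> / 2) / \<epsilon>) = P ((x - \<epsilon> / 2) / \<epsilon>)"
    using P_periodic by simp
  \<comment> \<open>The quadratic term in \<open>y - x\<close> cancels by symmetry, and the two
    contributions of \<open>\<beta> * F x\<close> cancel each other.\<close>
  then have N_diff: "N (x + \<epsilon> / 2) - N (x - \<epsilon> / 2) = \<epsilon> * (m * (k * x - \<Phi> x) + \<epsilon> * \<beta> * k)"
    unfolding N_def by (simp add: field_simps power2_eq_square)
  have "\<bar>(W (x + \<epsilon> / 2) - N (x + \<epsilon> / 2)) - (W (x - \<epsilon> / 2) - N (x - \<epsilon> / 2))\<bar>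
      \<le> (error_constant * \<epsilon>\<^sup>2) * \<bar>(x + \<epsilon> / 2) - (x - \<epsilon> / 2)\<bar>"
  proof (rule increment_bound[of "x - \<epsilon> / 2" "x + \<epsilon> / 2" "\<lambda>y. W y - N y", OF DERIV_diff[OF W N]])
    fix y assume "y \<in> {x - \<epsilon> / 2..x + \<epsilon> / 2}"
    then show "\<bar>expansion \<epsilon> R k y - (m * (k * y - \<Phi> x - F x * (y - x))
      + \<epsilon> * (B (y / \<epsilon>) * (k - F x)) + \<epsilon> * \<beta> * F x)\<bar> \<le> error_constant * \<epsilon>\<^sup>2"
      using x \<epsilon> by (intro expansion_frozen[OF \<epsilon> R]) auto
  qed (use \<epsilon> in auto)
  also have "\<dots> = (error_constant * \<epsilon>\<^sup>2) * \<epsilon>" using \<epsilon> by simp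
  finally have "\<bar>(W (x + \<epsilon> / 2) - W (x - \<epsilon> / 2)) - \<epsilon> * (m * (k * x - \<Phi> x) + \<epsilon> * \<beta> * k)\<bar>
      \<le> (error_constant * \<epsilon>\<^sup>2) * \<epsilon>"
    using N_diff by (simp add: algebra_simps)
  then have "\<bar>\<epsilon> * (1 / \<epsilon> * (W (x + \<epsilon> / 2) - W (x - \<epsilon> / 2))
      - (m * (k * x - \<Phi> x) + \<epsilon> * \<beta> * k))\<bar> \<le> (error_constant * \<epsilon>\<^sup>2) * \<epsilon>"
    using \<epsilon> by (simp add: right_diff_distrib)
  then show ?thesis
    unfolding avg abs_mult using \<epsilon> by (simp add: mult.commute[of _ \<epsilon>])
qed

text \<open>The average still contains \<open>k\<close>. Its boundary identity turns
  \<open>m * k * x\<close> into \<open>m * \<Phi> 1 * x\<close> plus the linear correction, while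
  \<open>\<epsilon> * \<beta> * k\<close> gives the constant correction; both replacements cost
  order \<open>\<epsilon>\<^sup>2\<close>.\<close>

lemma averaged_error:
  assumes \<epsilon>: "\<epsilon> > 0" "1 / \<epsilon> \<in> \<nat>"
    and u\<^sub>\<epsilon>: "\<And>x. x \<in> {0..1} \<Longrightarrow>
      (u\<^sub>\<epsilon> has_real_derivative b (x / \<epsilon>) * (k - F x)) (at x within {0..1})"
    and u\<^sub>\<epsilon>_bdry: "u\<^sub>\<epsilon> 0 = 0" "u\<^sub>\<epsilon> 1 = 0"
    and u: "\<And>x. x \<in> {0..1} \<Longrightarrow>
      (u has_real_derivative m * (k\<^sub>0 - F x)) (at x within {0..1})"
    and u_bdry: "u 0 = 0" "u 1 = 0"
    and x: "x \<in> {\<epsilon><..<1 - \<epsilon>}"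
  shows "\<bar>1 / \<epsilon> * (LBINT y=ereal (x - \<epsilon> / 2)..ereal (x + \<epsilon> / 2). u\<^sub>\<epsilon> y)
      - (\<epsilon> * F 1 * (- \<beta>) * x + \<epsilon> * \<Phi> 1 * \<beta>) - u x\<bar>
    \<le> (error_constant + K\<^sub>P * K' + \<bar>\<beta>\<bar> * ((K\<^sub>P * K' + \<bar>\<beta>\<bar> * K) / m)) * \<epsilon>\<^sup>2"
proof -
  have "continuous_on UNIV P" by (rule DERIV_continuous_on[OF P_deriv])
  then have "continuous_on UNIV (\<lambda>x. P (x / \<epsilon>))"
    by (rule continuous_on_compose2) (use \<epsilon> in \<open>auto intro!: continuous_intros\<close>)
  then have cont: "continuous_on UNIV (\<lambda>x. P (x / \<epsilon>) * f' x)"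
    by (rule continuous_on_mult[OF _ f'_cont])
  obtain R where R: "R 0 = 0" "\<And>x. (R has_real_derivative P (x / \<epsilon>) * f' x) (at x)"
    by (rule primitive_exists[OF cont]) blast
  have sol: "\<And>x. x \<in> {0..1} \<Longrightarrow> u\<^sub>\<epsilon> x = expansion \<epsilon> R k x"
    "m * (k - \<Phi> 1) = \<epsilon>\<^sup>2 * R 1 - \<epsilon> * \<beta> * F 1"
    by (rule oscillating_solution[OF \<epsilon> R(2,1) u\<^sub>\<epsilon> u\<^sub>\<epsilon>_bdry]; assumption)+
  have x01: "x \<in> {0..1}" "\<epsilon> \<le> 1" using x \<epsilon> by auto
  \<comment> \<open>The window lies inside \<open>[0,1]\<close>, where the solution coincides with
    its expansion.\<close>
  have "(LBINT y=ereal (x - \<epsilon> / 2)..ereal (x + \<epsilon> / 2). u\<^sub>\<epsilon> y)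
      = (LBINT y=ereal (x - \<epsilon> / 2)..ereal (x + \<epsilon> / 2). expansion \<epsilon> R k y)"
    by (rule interval_integral_cong) (use x \<epsilon> sol(1) in \<open>auto simp: einterval_iff min_def max_def\<close>)
  with window_average[OF \<epsilon>(1) R(2,1) x, of k]
  have avg: "\<bar>1 / \<epsilon> * (LBINT y=ereal (x - \<epsilon> / 2)..ereal (x + \<epsilon> / 2). u\<^sub>\<epsilon> y)
      - (m * (k * x - \<Phi> x) + \<epsilon> * \<beta> * k)\<bar> \<le> error_constant * \<epsilon>\<^sup>2" by simp
  have R1: "\<bar>R 1\<bar> \<le> K\<^sub>P * K'" using corrector_bound[OF \<epsilon>(1) R(2,1)] by auto
  have F1: "\<bar>F 1\<bar> \<le> K" using F_lipschitz[of 0 1] F_0 by simp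
  have "m * \<bar>k - \<Phi> 1\<bar> = \<bar>\<epsilon>\<^sup>2 * R 1 - \<epsilon> * \<beta> * F 1\<bar>"
    using sol(2) m_pos by (metis abs_mult abs_of_pos)
  also have "\<dots> \<le> \<epsilon>\<^sup>2 * \<bar>R 1\<bar> + \<epsilon> * \<bar>\<beta>\<bar> * \<bar>F 1\<bar>"
    using \<epsilon> abs_triangle_ineq4[of "\<epsilon>\<^sup>2 * R 1" "\<epsilon> * \<beta> * F 1"] by (simp add: abs_mult)
  \<comment> \<open>One factor \<epsilon> is given away by \<open>\<epsilon> \<le> 1\<close>: first
    order suffices for \<open>k - \<Phi> 1\<close>, since \<open>e2\<close> below multiplies it by
    \<epsilon> again.\<close>
  also have "\<dots> \<le> \<epsilon> * (K\<^sub>P * K') + \<epsilon> * \<bar>\<beta>\<bar> * K"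
    using \<epsilon> R1 F1 x01(2) by (intro add_mono mult_mono) (auto simp: power2_eq_square)
  also have "\<dots> = \<epsilon> * (K\<^sub>P * K' + \<bar>\<beta>\<bar> * K)" by (simp add: algebra_simps)
  finally have k: "\<bar>k - \<Phi> 1\<bar> \<le> \<epsilon> * ((K\<^sub>P * K' + \<bar>\<beta>\<bar> * K) / m)"
    using m_pos by (simp add: field_simps)
  define e1 where "e1 = \<epsilon>\<^sup>2 * (R 1 * x)"
  define e2 where "e2 = \<epsilon> * (\<beta> * (k - \<Phi> 1))"
  have "\<bar>R 1\<bar> * \<bar>x\<bar> \<le> (K\<^sub>P * K') * 1"
    using R1 x01 by (intro mult_mono) (use bounds_nonneg in auto)
  then have e1: "\<bar>e1\<bar> \<le> \<epsilon>\<^sup>2 * (K\<^sub>P * K')"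
    unfolding e1_def abs_mult by (auto intro!: mult_left_mono)
  have e2: "\<bar>e2\<bar> \<le> \<epsilon> * (\<bar>\<beta>\<bar> * (\<epsilon> * ((K\<^sub>P * K' + \<bar>\<beta>\<bar> * K) / m)))"
    unfolding e2_def abs_mult abs_of_pos[OF \<epsilon>(1)]
    using \<epsilon> by (intro mult_left_mono k) auto
  have u_x: "u x = m * (\<Phi> 1 * x - \<Phi> x)"
    by (rule homogenized_solution[OF u u_bdry x01(1)])
  have "m * (k * x - \<Phi> x) + \<epsilon> * \<beta> * k - (\<epsilon> * F 1 * (- \<beta>) * x + \<epsilon> * \<Phi> 1 * \<beta>) - u x
      = (m * (k - \<Phi> 1)) * x + \<epsilon> * \<beta> * F 1 * x + e2"
    unfolding u_x e2_def by (simp add: algebra_simps)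
  also have "\<dots> = e1 + e2"
    unfolding sol(2) e1_def by (simp add: algebra_simps)
  finally have "\<bar>1 / \<epsilon> * (LBINT y=ereal (x - \<epsilon> / 2)..ereal (x + \<epsilon> / 2). u\<^sub>\<epsilon> y)
      - (\<epsilon> * F 1 * (- \<beta>) * x + \<epsilon> * \<Phi> 1 * \<beta>) - u x\<bar>
    \<le> error_constant * \<epsilon>\<^sup>2 + \<epsilon>\<^sup>2 * (K\<^sub>P * K')
      + \<epsilon> * (\<bar>\<beta>\<bar> * (\<epsilon> * ((K\<^sub>P * K' + \<bar>\<beta>\<bar> * K) / m)))"
    using avg e1 e2 by linarith
  also have "\<dots> = (error_constant + K\<^sub>P * K' + \<bar>\<beta>\<bar> * ((K\<^sub>P * K' + \<bar>\<beta>\<bar> * K) / m)) * \<epsilon>\<^sup>2"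
    by (simp add: algebra_simps power2_eq_square)
  finally show ?thesis .
qed

lemma error_constant_nonneg: "0 \<le> error_constant"
  unfolding error_constant_def using m_pos bounds_nonneg by (intro add_nonneg_nonneg) auto

end

section \<open>Construction of the correctors and identification of the affine function\<close>

theorem mainTheorem1:
  fixes a f :: "real \<Rightarrow> real"
  assumes a_cont: "continuous_on UNIV a"
    and a_pos: "\<forall>x. 0 < a x"
    and a_periodic: "\<forall>x. a (x + 1) = a x"
    and f_smooth: "smooth_on_interval {0..1} f"
  shows "\<exists>C>0. \<forall>\<epsilon>::real. \<forall>u\<^sub>\<epsilon> u :: real \<Rightarrow> real.
    0 < \<epsilon> \<longrightarrow> 1 / \<epsilon> \<in> \<nat> \<longrightarrow>
    dirichlet_solution (\<lambda>x. a (x / \<epsilon>)) f u\<^sub>\<epsilon> \<longrightarrow>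
    dirichlet_solution (\<lambda>_. homogenized_coeff a) f u \<longrightarrow>
    (\<forall>x\<in>{\<epsilon><..<1 - \<epsilon>}.
      \<bar>1 / \<epsilon> * (LBINT y=x - \<epsilon> / 2..x + \<epsilon> / 2. u\<^sub>\<epsilon> y) - affine_corrector a f \<epsilon> x - u x\<bar>
        \<le> C * \<epsilon>\<^sup>2)"
proof -
  define b where "b = (\<lambda>y. inverse (a y))"
  have a_nz: "a y \<noteq> 0" for y using a_pos by (metis less_irrefl)
  have b_cont: "continuous_on UNIV b"
    unfolding b_def using a_cont a_nz by (intro continuous_intros) auto
  obtain A where A: "A 0 = 0" "\<And>y. (A has_real_derivative b y) (at y)"
    by (rule primitive_exists[OF b_cont]) blast
  \<comment> \<open>As \<open>A 0 = 0\<close>, this is the mean of \<open>b\<close>; it makes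
    \<open>B 1 = B 0\<close>, hence \<open>B\<close> periodic. The choice of \<open>\<beta>\<close>
    below does the same for \<open>P\<close>.\<close>
  define m where "m = A 1"
  define B where "B = (\<lambda>y. A y - m * y)"
  have B_deriv: "(B has_real_derivative b y - m) (at y)" for y
    unfolding B_def using A(2) by (auto intro!: derivative_eq_intros)
  have B_cont: "continuous_on UNIV B" by (rule DERIV_continuous_on[OF B_deriv])
  obtain Q where Q: "Q 0 = 0" "\<And>y. (Q has_real_derivative B y) (at y)"
    by (rule primitive_exists[OF B_cont]) blast
  define \<beta> where "\<beta> = Q 1"
  define P where "P = (\<lambda>y. Q y - \<beta> * y)"
  have P_deriv: "(P has_real_derivative B y - \<beta>) (at y)" for y
    unfolding P_def using Q(2) by (auto intro!: derivative_eq_intros)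
  have P_cont: "continuous_on UNIV P" by (rule DERIV_continuous_on[OF P_deriv])
  have B_per: "B (y + 1) = B y" for y
    by (rule periodic_primitive[OF B_deriv])
      (use a_periodic A(1) in \<open>auto simp: b_def B_def m_def\<close>)
  have P_per: "P (y + 1) = P y" for y
    by (rule periodic_primitive[OF P_deriv])
      (use B_per Q(1) in \<open>auto simp: P_def \<beta>_def\<close>)
  have m_pos: "0 < m"
    using DERIV_pos_imp_increasing[of 0 1 A] A a_pos unfolding m_def b_def
    by (metis inverse_positive_iff_positive zero_less_one)
  obtain f\<^sub>e f' where f'_cont: "continuous_on UNIV f'"
    and f\<^sub>e: "\<And>x. (f\<^sub>e has_real_derivative f' x) (at x)"
    and f\<^sub>e_eq: "\<And>x. x \<in> {0..1} \<Longrightarrow> f\<^sub>e x = f x"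
    by (rule smooth_on_unit_interval_C1_extension[OF f_smooth]) blast
  have f\<^sub>e_cont: "continuous_on UNIV f\<^sub>e" by (rule DERIV_continuous_on[OF f\<^sub>e])
  obtain F where F: "F 0 = 0" "\<And>x. (F has_real_derivative f\<^sub>e x) (at x)"
    by (rule primitive_exists[OF f\<^sub>e_cont]) blast
  have F_cont: "continuous_on UNIV F" by (rule DERIV_continuous_on[OF F(2)])
  obtain \<Phi> where \<Phi>: "\<Phi> 0 = 0" "\<And>x. (\<Phi> has_real_derivative F x) (at x)"
    by (rule primitive_exists[OF F_cont]) blast
  obtain K\<^sub>B where "\<And>y. \<bar>B y\<bar> \<le> K\<^sub>B" using periodic_continuous_bounded[OF B_cont B_per] by blast
  moreover obtain K\<^sub>P where "\<And>y. \<bar>P y\<bar> \<le> K\<^sub>P"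
    using periodic_continuous_bounded[OF P_cont P_per] by blast
  moreover obtain K where "\<And>x. x \<in> {0..1} \<Longrightarrow> \<bar>f\<^sub>e x\<bar> \<le> K"
    using bounded_on_unit_interval[OF continuous_on_subset[OF f\<^sub>e_cont]] by blast
  moreover obtain K' where "\<And>x. x \<in> {0..1} \<Longrightarrow> \<bar>f' x\<bar> \<le> K'"
    using bounded_on_unit_interval[OF continuous_on_subset[OF f'_cont]] by blast
  ultimately interpret oscillating_problem b B P m \<beta> f\<^sub>e f' F \<Phi> K\<^sub>B K\<^sub>P K K'
    using m_pos B_deriv P_deriv B_per P_per f'_cont f\<^sub>e F \<Phi> A(1) Q(1)
    by unfold_locales (auto simp: B_def P_def)

  \<comment> \<open>The integral is oriented, so this covers negative \<open>y\<close>, as the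
    integral over \<open>[-1/2, 1/2]\<close> requires.\<close>
  have A_int: "(LBINT z=0..ereal y. inverse (a z)) = A y" for y
    using interval_integral_eq_primitive[of 0 y b A] A continuous_on_subset[OF b_cont]
    by (simp add: b_def zero_ereal_def)
  have f_cont: "continuous_on {0..1} f"
    by (rule continuous_on_eq[OF continuous_on_subset[OF f\<^sub>e_cont]]) (use f\<^sub>e_eq in auto)
  have f_deriv: "(F has_real_derivative f x) (at x)" if "x \<in> {0..1}" for x
    using F(2)[of x] f\<^sub>e_eq[OF that] by simp
  have F_int: "(LBINT z=0..ereal y. f z) = F y" if "y \<in> {0..1}" for y
    using interval_integral_eq_primitive[of 0 y f F] F(1) that f_deriv
      continuous_on_subset[OF f_cont, of "{0..y}"]
    by (simp add: zero_ereal_def)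
  have \<Phi>_int: "(LBINT y=0..1. (LBINT z=0..ereal y. f z)) = \<Phi> 1"
  proof -
    have "(LBINT y=0..1. (LBINT z=0..ereal y. f z)) = (LBINT y=0..1. F y)"
      by (rule interval_integral_cong) (auto simp: einterval_iff F_int)
    also have "\<dots> = \<Phi> 1"
      using interval_integral_eq_primitive[of 0 1 F \<Phi>] \<Phi> continuous_on_subset[OF F_cont]
      by (simp add: zero_ereal_def one_ereal_def)
    finally show ?thesis .
  qed
  have A_cont: "continuous_on UNIV A" by (rule DERIV_continuous_on[OF A(2)])
  \<comment> \<open>\<open>A y\<close> equals \<open>B y + m * y\<close>, and \<open>B\<close> is
    the derivative of \<open>P\<close> plus \<open>\<beta>\<close>.\<close>
  have A_prim: "((\<lambda>y. P y + \<beta> * y + m * y\<^sup>2 / 2) has_real_derivative A y) (at y)" for y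
    using P_deriv[of y] by (auto intro!: derivative_eq_intros simp: B_def)
  have P_1: "P 1 = 0" using P_per[of 0] P_0 by simp
  have P_half: "P (1 / 2) = P (- 1 / 2)" using P_per[of "- 1 / 2"] by simp
  \<comment> \<open>Integration by parts: the boundary term \<open>m / 2\<close> cancels the
    quadratic part of the integral of \<open>A\<close>, which leaves the mean of \<open>B\<close>
    with a minus sign.\<close>
  have int1: "(LBINT y=0..1. inverse (a y) * (y - 1/2)) = - \<beta>"
  proof -
    have "((\<lambda>y. A y * (y - 1/2) - (P y + \<beta> * y + m * y\<^sup>2 / 2))
        has_real_derivative b y * (y - 1/2)) (at y)" for y
      by (rule derivative_eq_intros A(2) A_prim refl)+ simp
    then have "(LBINT y=ereal 0..ereal 1. b y * (y - 1/2)) = - \<beta>"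
      by (subst interval_integral_eq_primitive[where G =
            "\<lambda>y. A y * (y - 1/2) - (P y + \<beta> * y + m * y\<^sup>2 / 2)"])
        (auto simp: A(1) P_1 P_0 m_def intro!: continuous_intros continuous_on_subset[OF b_cont])
    then show ?thesis by (simp add: b_def zero_ereal_def one_ereal_def)
  qed
  \<comment> \<open>The quadratic part of the primitive is even and \<open>P\<close> agrees at both
    ends, so only \<open>\<beta> * y\<close> contributes.\<close>
  have int2: "(LBINT y=ereal (-1/2)..ereal (1/2). (LBINT z=0..ereal y. inverse (a z))) = \<beta>"
    unfolding A_int
    by (subst interval_integral_eq_primitive[OF continuous_on_subset[OF A_cont] A_prim])
      (auto simp: P_half power2_eq_square)
  have affine: "affine_corrector a f \<epsilon> x = \<epsilon> * F 1 * (- \<beta>) * x + \<epsilon> * \<Phi> 1 * \<beta>" for \<epsilon> x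
    unfolding affine_corrector_def int1 int2 \<Phi>_int
    using F_int[of 1] by (simp add: one_ereal_def)
  have hom: "homogenized_coeff a = inverse m"
    unfolding homogenized_coeff_def m_def
    using A_int[of 1] by (simp add: one_ereal_def inverse_eq_divide)

  \<comment> \<open>The last summand \<open>1\<close> makes \<open>C\<close> positive, since the
    others are only known to be nonnegative.\<close>
  define C where
    "C = error_constant + K\<^sub>P * K' + \<bar>\<beta>\<bar> * ((K\<^sub>P * K' + \<bar>\<beta>\<bar> * K) / m) + 1"
  have "0 < C"
    unfolding C_def using m_pos bounds_nonneg error_constant_nonneg
    by (intro add_nonneg_pos add_nonneg_nonneg) auto
  moreover have "\<bar>1 / \<epsilon> * (LBINT y=x - \<epsilon> / 2..x + \<epsilon> / 2. u\<^sub>\<epsilon> y) - affine_corrector a f \<epsilon> x - u x\<bar>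
        \<le> C * \<epsilon>\<^sup>2"
    if \<epsilon>: "0 < \<epsilon>" "1 / \<epsilon> \<in> \<nat>"
      and u\<^sub>\<epsilon>: "dirichlet_solution (\<lambda>x. a (x / \<epsilon>)) f u\<^sub>\<epsilon>"
      and u: "dirichlet_solution (\<lambda>_. homogenized_coeff a) f u"
      and x: "x \<in> {\<epsilon><..<1 - \<epsilon>}" for \<epsilon> u\<^sub>\<epsilon> u x
  proof -
    obtain k where k: "\<And>x. x \<in> {0..1} \<Longrightarrow>
        (u\<^sub>\<epsilon> has_real_derivative b (x / \<epsilon>) * (k - F x)) (at x within {0..1})"
      using dirichlet_solution_derivative[OF u\<^sub>\<epsilon> _ f_deriv f_cont] a_nz
      unfolding b_def by (auto simp: field_simps)
    obtain k\<^sub>0 where k\<^sub>0: "\<And>x. x \<in> {0..1} \<Longrightarrow>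
        (u has_real_derivative m * (k\<^sub>0 - F x)) (at x within {0..1})"
      using dirichlet_solution_derivative[OF u _ f_deriv f_cont] m_pos
      unfolding hom by (auto simp: field_simps)
    have "u\<^sub>\<epsilon> 0 = 0" "u\<^sub>\<epsilon> 1 = 0" "u 0 = 0" "u 1 = 0"
      using u\<^sub>\<epsilon> u unfolding dirichlet_solution_def by auto
    from averaged_error[OF \<epsilon> k this(1,2) k\<^sub>0 this(3,4) x]
    have "\<bar>1 / \<epsilon> * (LBINT y=ereal (x - \<epsilon> / 2)..ereal (x + \<epsilon> / 2). u\<^sub>\<epsilon> y) - affine_corrector a f \<epsilon> x - u x\<bar>
        \<le> (C - 1) * \<epsilon>\<^sup>2"
      unfolding affine C_def by simp
    also have "\<dots> \<le> C * \<epsilon>\<^sup>2" by (intro mult_right_mono) auto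
    finally show ?thesis .
  qed
  ultimately show ?thesis by blast
qed

end
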